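(* Let $n\in\mathbb{N}$ and let $\mathbf{k}$ be a commutative ring. Let $i\in[n-1]$. Then, in $\mathbf{k}[S_n]$, $$t_{i+1}t_i=(t_i-1)\,t_i=t_i\,(t_i-1).$$
   Context: Here $\mathbb{N}=\{0,1,2,\ldots\}$, and $[m]:=\{1,2,\ldots,m\}$ (empty if $m\leq 0$). $S_n$ is the symmetric group on $[n]$, with product $(\pi\sigma)(i)=\pi(\sigma(i))$, viewed as a subset of the group algebra $\mathbf{k}[S_n]$. For distinct $i_1,\ldots,i_k\in[n]$, $\operatorname{cyc}_{i_1,\ldots,i_k}\in S_n$ is the cycle sending $i_1\mapsto i_2\mapsto\cdots\mapsto i_k\mapsto i_1$ and fixing all other elements (so $\operatorname{cyc}_i=\operatorname{id}=1$). For each $\ell\in[n]$, the somewhere-to-below shuffle is $t_\ell:=\operatorname{cyc}_{\ell}+\operatorname{cyc}_{\ell,\ell+1}+\operatorname{cyc}_{\ell,\ell+1,\ell+2}+\cdots+\operatorname{cyc}_{\ell,\ell+1,\ldots,n}\in\mathbf{k}[S_n]$. *)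

theory Defs
  imports "HOL-Algebra.Ring" "HOL-Algebra.Sym_Groups"
begin

text \<open>The group algebra of a group \<open>G\<close> over a ring \<open>R\<close>: an element
  \<open>\<Sum>\<^sub>g f\<^sub>g g\<close> is represented by its coefficient function \<open>f\<close>, which is
  finitely supported, and \<open>undefined\<close> outside of the carrier of \<open>G\<close>.  In the product,
  the coefficient of \<open>w\<close> is the sum of \<open>f\<^sub>u g\<^sub>v\<close> over all \<open>u v = w\<close>; it is
  indexed by \<open>u\<close> in the support of \<open>f\<close>, because \<open>finsum\<close> is junk on infinite
  index sets.\<close>

definition group_algebra ::
    "('r, 'm) ring_scheme \<Rightarrow> ('g, 'n) monoid_scheme \<Rightarrow> ('g \<Rightarrow> 'r) ring" where
  "group_algebra R G =
    \<lparr> carrier = {f \<in> carrier G \<rightarrow>\<^sub>E carrier R. finite {g \<in> carrier G. f g \<noteq> \<zero>\<^bsub>R\<^esub>}},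
      monoid.mult = (\<lambda>f g. \<lambda>w \<in> carrier G.
        \<Oplus>\<^bsub>R\<^esub>u \<in> {u \<in> carrier G. f u \<noteq> \<zero>\<^bsub>R\<^esub>}. f u \<otimes>\<^bsub>R\<^esub> g (inv\<^bsub>G\<^esub> u \<otimes>\<^bsub>G\<^esub> w)),
      one = (\<lambda>w \<in> carrier G. if w = \<one>\<^bsub>G\<^esub> then \<one>\<^bsub>R\<^esub> else \<zero>\<^bsub>R\<^esub>),
      zero = (\<lambda>w \<in> carrier G. \<zero>\<^bsub>R\<^esub>),
      add = (\<lambda>f g. \<lambda>w \<in> carrier G. f w \<oplus>\<^bsub>R\<^esub> g w) \<rparr>"

text \<open>The embedding of \<open>G\<close> into its group algebra.\<close>

definition group_algebra_of ::
    "('r, 'm) ring_scheme \<Rightarrow> ('g, 'n) monoid_scheme \<Rightarrow> 'g \<Rightarrow> 'g \<Rightarrow> 'r" where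
  "group_algebra_of R G g = (\<lambda>w \<in> carrier G. if w = g then \<one>\<^bsub>R\<^esub> else \<zero>\<^bsub>R\<^esub>)"

text \<open>The somewhere-to-below shuffle \<open>t\<^sub>l\<close>; the list \<open>[l..<Suc m]\<close> is \<open>l, l + 1, \<dots>, m\<close>.\<close>

definition somewhere_to_below ::
    "('r, 'm) ring_scheme \<Rightarrow> nat \<Rightarrow> nat \<Rightarrow> (nat \<Rightarrow> nat) \<Rightarrow> 'r" where
  "somewhere_to_below R n l =
    (\<Oplus>\<^bsub>group_algebra R (sym_group n)\<^esub>m \<in> {l..n}.
      group_algebra_of R (sym_group n) (cycle_of_list [l..<Suc m]))"

end

theory Submission
  imports Defs
begin

text \<open>Write \<open>c\<^sub>l\<^sub>,\<^sub>m\<close> for the cycle \<open>l \<mapsto> l + 1 \<mapsto> \<dots> \<mapsto> m \<mapsto> l\<close>.  Since \<open>t\<^sub>i - 1\<close> is the sum of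
  \<open>c\<^sub>i\<^sub>,\<^sub>m\<close> over \<open>i < m \<le> n\<close>, both \<open>t\<^sub>i\<^sub>+\<^sub>1 t\<^sub>i\<close> and \<open>(t\<^sub>i - 1) t\<^sub>i\<close> are sums over the pairs \<open>(m, k)\<close>
  with \<open>i < m \<le> n\<close> and \<open>i \<le> k \<le> n\<close>.  The summands are matched by the involution
  \<open>(m, k) \<mapsto> (k + 1, m)\<close> for \<open>k < m\<close>, \<open>(m, k) \<mapsto> (k, m - 1)\<close> for \<open>m \<le> k\<close>, because
  \<open>c\<^sub>i\<^sub>,\<^sub>m c\<^sub>i\<^sub>,\<^sub>k\<close> equals \<open>c\<^sub>i\<^sub>+\<^sub>1\<^sub>,\<^sub>k\<^sub>+\<^sub>1 c\<^sub>i\<^sub>,\<^sub>m\<close> in the first case and \<open>c\<^sub>i\<^sub>+\<^sub>1\<^sub>,\<^sub>k c\<^sub>i\<^sub>,\<^sub>m\<^sub>-\<^sub>1\<close> in the second.\<close>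

section \<open>Finite sums and products over product sets\<close>

lemma (in comm_monoid) finprod_Times:
  assumes "finite A" and "finite B" and h: "h \<in> A \<times> B \<rightarrow> carrier G"
  shows "finprod G h (A \<times> B) = (\<Otimes>a\<in>A. \<Otimes>b\<in>B. h (a, b))"
proof -
  \<comment> \<open>The product set is cut into the fibres over the points of \<open>A\<close>; they
    are disjoint, and each is the image of \<open>B\<close> under the injective map
    \<open>Pair a\<close>.\<close>
  have "finprod G h (A \<times> B) = finprod G h (\<Union>a\<in>A. Pair a ` B)"
    by (rule arg_cong[where f = "finprod G h"]) auto
  also have "\<dots> = (\<Otimes>a\<in>A. finprod G h (Pair a ` B))"
    by (rule finprod_UN_disjoint) (use assms in \<open>auto simp: pairwise_def disjnt_def\<close>)
  also have "\<dots> = (\<Otimes>a\<in>A. \<Otimes>b\<in>B. h (a, b))"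
  proof (rule finprod_cong')
    fix a assume "a \<in> A"
    then show "finprod G h (Pair a ` B) = (\<Otimes>b\<in>B. h (a, b))"
      using h by (intro finprod_reindex) (auto simp: inj_on_def)
  qed (use h in \<open>auto intro!: finprod_closed\<close>)
  finally show ?thesis .
qed

text \<open>Both iterated products are products over a product set, and \<open>prod.swap\<close>
  carries one index set to the other. The additive version exchanges the double sum in the proof of
  associativity.\<close>

lemma (in comm_monoid) finprod_swap:
  assumes "finite A" and "finite B"
    and h: "\<And>a b. a \<in> A \<Longrightarrow> b \<in> B \<Longrightarrow> h a b \<in> carrier G"
  shows "(\<Otimes>a\<in>A. \<Otimes>b\<in>B. h a b) = (\<Otimes>b\<in>B. \<Otimes>a\<in>A. h a b)"
proof -
  have "(\<Otimes>a\<in>A. \<Otimes>b\<in>B. h a b) = finprod G (case_prod h) (prod.swap ` (B \<times> A))"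
    unfolding product_swap using finprod_Times[of A B "case_prod h"] assms by (simp add: Pi_iff)
  also have "\<dots> = finprod G (\<lambda>(b, a). h a b) (B \<times> A)"
    by (subst finprod_reindex) (use h in \<open>auto intro!: finprod_cong' simp: inj_on_def\<close>)
  also have "\<dots> = (\<Otimes>b\<in>B. \<Otimes>a\<in>A. h a b)"
    using finprod_Times[of B A "\<lambda>(b, a). h a b"] assms by (simp add: Pi_iff)
  finally show ?thesis .
qed

text \<open>Distributivity on each side in turn. Gathering the result into one sum over pairs allows
  a reindexing that mixes the two indices.\<close>

lemma (in ring) finsum_mult_finsum:
  assumes "finite A" and "finite B" and f: "f \<in> A \<rightarrow> carrier R" and g: "g \<in> B \<rightarrow> carrier R"
  shows "finsum R f A \<otimes> finsum R g B = finsum R (\<lambda>(a, b). f a \<otimes> g b) (A \<times> B)"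
proof -
  have "finsum R f A \<otimes> finsum R g B = (\<Oplus>a\<in>A. f a \<otimes> finsum R g B)"
    by (rule finsum_ldistr) (use assms in auto)
  also have "\<dots> = (\<Oplus>a\<in>A. \<Oplus>b\<in>B. f a \<otimes> g b)"
    by (rule finsum_cong') (use assms in \<open>auto intro!: finsum_closed finsum_rdistr\<close>)
  also have "\<dots> = finsum R (\<lambda>(a, b). f a \<otimes> g b) (A \<times> B)"
    by (subst add.finprod_Times) (use assms in auto)
  finally show ?thesis .
qed


subsection \<open>The group algebra is a ring\<close>

text \<open>The group may be infinite here, so every sum owes its finiteness to a support.\<close>

locale ring_and_group = R: ring R + G: group G for R (structure) and G (structure)
begin

abbreviation A where "A \<equiv> group_algebra R G"

abbreviation supp where "supp f \<equiv> {g \<in> carrier G. f g \<noteq> \<zero>}"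

section \<open>Coefficients of elements and products\<close>

lemma carrier_group_algebra:
  "f \<in> carrier A \<longleftrightarrow> f \<in> carrier G \<rightarrow>\<^sub>E carrier R \<and> finite (supp f)"
  by (simp add: group_algebra_def)

lemma coeff_closed [simp]: "f \<in> carrier A \<Longrightarrow> w \<in> carrier G \<Longrightarrow> f w \<in> carrier R"
  by (auto simp: carrier_group_algebra)

lemma group_algebra_eqI:
  assumes "f \<in> carrier A" and "g \<in> carrier A" and "\<And>w. w \<in> carrier G \<Longrightarrow> f w = g w"
  shows "f = g"
  using assms by (auto simp: carrier_group_algebra intro: PiE_ext)

lemma coeff_zero [simp]: "w \<in> carrier G \<Longrightarrow> \<zero>\<^bsub>A\<^esub> w = \<zero>"
  by (simp add: group_algebra_def)

lemma coeff_one: "w \<in> carrier G \<Longrightarrow> \<one>\<^bsub>A\<^esub> w = (if w = \<one>\<^bsub>G\<^esub> then \<one> else \<zero>)"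
  by (simp add: group_algebra_def)

lemma coeff_add [simp]: "w \<in> carrier G \<Longrightarrow> (f \<oplus>\<^bsub>A\<^esub> g) w = f w \<oplus> g w"
  by (simp add: group_algebra_def)

text \<open>Enlarging the index set beyond \<open>supp f\<close> only adds terms with
  \<open>f u = \<zero>\<close>. The freedom in \<open>S\<close> lets several products be expanded
  over one common index set.\<close>

lemma coeff_mult:
  assumes "f \<in> carrier A" and "g \<in> carrier A" and w: "w \<in> carrier G"
    and "finite S" and "supp f \<subseteq> S" and "S \<subseteq> carrier G"
  shows "(f \<otimes>\<^bsub>A\<^esub> g) w = (\<Oplus>u\<in>S. f u \<otimes> g (inv\<^bsub>G\<^esub> u \<otimes>\<^bsub>G\<^esub> w))"
proof -
  have "(f \<otimes>\<^bsub>A\<^esub> g) w = (\<Oplus>u\<in>supp f. f u \<otimes> g (inv\<^bsub>G\<^esub> u \<otimes>\<^bsub>G\<^esub> w))"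
    using w by (simp add: group_algebra_def)
  also have "\<dots> = (\<Oplus>u\<in>S. f u \<otimes> g (inv\<^bsub>G\<^esub> u \<otimes>\<^bsub>G\<^esub> w))"
    by (rule R.add.finprod_mono_neutral_cong_left) (use assms in \<open>auto simp: subset_iff\<close>)
  finally show ?thesis .
qed

section \<open>Closure under the ring operations\<close>

lemma zero_closed: "\<zero>\<^bsub>A\<^esub> \<in> carrier A"
  by (auto simp: group_algebra_def)

lemma group_algebra_of_closed: "x \<in> carrier G \<Longrightarrow> group_algebra_of R G x \<in> carrier A"
  by (auto simp: carrier_group_algebra group_algebra_of_def intro: finite_subset[of _ "{x}"])

lemma one_eq: "\<one>\<^bsub>A\<^esub> = group_algebra_of R G \<one>\<^bsub>G\<^esub>"
  by (simp add: group_algebra_def group_algebra_of_def)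

lemma one_closed: "\<one>\<^bsub>A\<^esub> \<in> carrier A"
  by (simp add: one_eq group_algebra_of_closed)

lemma add_closed:
  assumes "f \<in> carrier A" and "g \<in> carrier A"
  shows "f \<oplus>\<^bsub>A\<^esub> g \<in> carrier A"
proof -
  have "supp (f \<oplus>\<^bsub>A\<^esub> g) \<subseteq> supp f \<union> supp g"
    by auto
  then have "finite (supp (f \<oplus>\<^bsub>A\<^esub> g))"
    by (rule finite_subset) (use assms in \<open>auto simp: carrier_group_algebra\<close>)
  then show ?thesis
    using assms by (auto simp: group_algebra_def)
qed

text \<open>A nonzero coefficient at \<open>w\<close> needs some \<open>u\<close> in
  \<open>supp f\<close> whose complementary factor, the inverse of \<open>u\<close> times
  \<open>w\<close>, lies in \<open>supp g\<close>. The finite bound gives closure under the product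
  and serves as an index set for associativity.\<close>

lemma supp_mult:
  assumes f: "f \<in> carrier A" and g: "g \<in> carrier A"
  shows "supp (f \<otimes>\<^bsub>A\<^esub> g) \<subseteq> (\<lambda>(u, v). u \<otimes>\<^bsub>G\<^esub> v) ` (supp f \<times> supp g)" (is "_ \<subseteq> ?P")
proof (rule ccontr)
  assume "\<not> supp (f \<otimes>\<^bsub>A\<^esub> g) \<subseteq> ?P"
  then obtain w where w: "w \<in> carrier G" "(f \<otimes>\<^bsub>A\<^esub> g) w \<noteq> \<zero>" "w \<notin> ?P"
    by auto
  have "g (inv\<^bsub>G\<^esub> u \<otimes>\<^bsub>G\<^esub> w) = \<zero>" if "u \<in> supp f" for u
  proof (rule ccontr)
    assume "g (inv\<^bsub>G\<^esub> u \<otimes>\<^bsub>G\<^esub> w) \<noteq> \<zero>"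
    moreover have "w = u \<otimes>\<^bsub>G\<^esub> (inv\<^bsub>G\<^esub> u \<otimes>\<^bsub>G\<^esub> w)"
      using that w by (simp flip: G.m_assoc)
    ultimately have "w \<in> ?P"
      using that w by (intro image_eqI[of _ _ "(u, inv\<^bsub>G\<^esub> u \<otimes>\<^bsub>G\<^esub> w)"]) auto
    then show False
      using w by simp
  qed
  then have "(\<Oplus>u\<in>supp f. f u \<otimes> g (inv\<^bsub>G\<^esub> u \<otimes>\<^bsub>G\<^esub> w)) = (\<Oplus>u\<in>supp f. \<zero>)"
    by (intro R.finsum_cong') (use f in auto)
  then have "(f \<otimes>\<^bsub>A\<^esub> g) w = (\<Oplus>u\<in>supp f. \<zero>)"
    using w by (simp add: group_algebra_def)
  then show False
    using w by (simp add: R.finsum_zero)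
qed

lemma mult_closed:
  assumes f: "f \<in> carrier A" and g: "g \<in> carrier A"
  shows "f \<otimes>\<^bsub>A\<^esub> g \<in> carrier A"
proof -
  have "finite (supp (f \<otimes>\<^bsub>A\<^esub> g))"
    by (rule finite_subset[OF supp_mult[OF f g]]) (use f g in \<open>auto simp: carrier_group_algebra\<close>)
  moreover have "(f \<otimes>\<^bsub>A\<^esub> g) w \<in> carrier R" if "w \<in> carrier G" for w
    by (subst coeff_mult[of _ _ _ "supp f"])
      (use f g that in \<open>auto intro!: R.finsum_closed simp: carrier_group_algebra[of f]\<close>)
  moreover have "f \<otimes>\<^bsub>A\<^esub> g \<in> extensional (carrier G)"
    by (simp add: group_algebra_def)
  ultimately show ?thesis
    by (auto simp: carrier_group_algebra PiE_def)
qed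

text \<open>Both coefficients at \<open>w\<close> become the sum of \<open>?h u x\<close> over
  \<open>u\<close> in \<open>S\<close> and \<open>x\<close> in \<open>P\<close>, where
  \<open>u\<close> is the first factor and \<open>x\<close> the product of the first two.\<close>

lemma mult_assoc:
  assumes f: "f \<in> carrier A" and g: "g \<in> carrier A" and h: "h \<in> carrier A"
  shows "(f \<otimes>\<^bsub>A\<^esub> g) \<otimes>\<^bsub>A\<^esub> h = f \<otimes>\<^bsub>A\<^esub> (g \<otimes>\<^bsub>A\<^esub> h)"
proof (rule group_algebra_eqI)
  fix w assume w: "w \<in> carrier G"
  define S where "S = supp f"
  define P where "P = (\<lambda>(u, v). u \<otimes>\<^bsub>G\<^esub> v) ` (supp f \<times> supp g)"
  have S: "finite S" "S \<subseteq> carrier G" "supp f \<subseteq> S"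
    using f by (auto simp: S_def carrier_group_algebra)
  have P: "finite P" "P \<subseteq> carrier G" "supp (f \<otimes>\<^bsub>A\<^esub> g) \<subseteq> P"
    using f g supp_mult[OF f g] by (auto simp: P_def carrier_group_algebra)
  have S_P: "u \<otimes>\<^bsub>G\<^esub> v \<in> P" if "u \<in> S" "v \<in> supp g" for u v
    using that by (auto simp: P_def S_def)
  have S_carrier: "u \<in> carrier G" if "u \<in> S" for u
    using S that by auto
  have P_carrier: "x \<in> carrier G" if "x \<in> P" for x
    using P that by auto
  note [simp] = f g h w S(1) P(1) S_carrier P_carrier
  have coeff_gh: "(g \<otimes>\<^bsub>A\<^esub> h) (inv\<^bsub>G\<^esub> u \<otimes>\<^bsub>G\<^esub> w) =
      (\<Oplus>x\<in>P. g (inv\<^bsub>G\<^esub> u \<otimes>\<^bsub>G\<^esub> x) \<otimes> h (inv\<^bsub>G\<^esub> x \<otimes>\<^bsub>G\<^esub> w))" if u: "u \<in> S" for u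
  proof -
    \<comment> \<open>The translate of \<open>P\<close> by the inverse of \<open>u\<close> contains
      \<open>supp g\<close>, because \<open>u\<close> times a point of \<open>supp g\<close> lies in
      \<open>P\<close>. Substituting along this translation gives an index set independent of
      \<open>u\<close>, as the exchange of sums requires.\<close>
    let ?T = "(\<lambda>x. inv\<^bsub>G\<^esub> u \<otimes>\<^bsub>G\<^esub> x) ` P"
    have "supp g \<subseteq> ?T"
    proof
      fix v assume v: "v \<in> supp g"
      then have "u \<otimes>\<^bsub>G\<^esub> v \<in> P"
        using u by (intro S_P)
      moreover have "v = inv\<^bsub>G\<^esub> u \<otimes>\<^bsub>G\<^esub> (u \<otimes>\<^bsub>G\<^esub> v)"
        using u v by (simp flip: G.m_assoc)
      ultimately show "v \<in> ?T"
        by blast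
    qed
    then have "(g \<otimes>\<^bsub>A\<^esub> h) (inv\<^bsub>G\<^esub> u \<otimes>\<^bsub>G\<^esub> w) =
        (\<Oplus>v\<in>?T. g v \<otimes> h (inv\<^bsub>G\<^esub> v \<otimes>\<^bsub>G\<^esub> (inv\<^bsub>G\<^esub> u \<otimes>\<^bsub>G\<^esub> w)))"
      using u by (intro coeff_mult) auto
    also have "\<dots> = (\<Oplus>x\<in>P. g (inv\<^bsub>G\<^esub> u \<otimes>\<^bsub>G\<^esub> x) \<otimes>
        h (inv\<^bsub>G\<^esub> (inv\<^bsub>G\<^esub> u \<otimes>\<^bsub>G\<^esub> x) \<otimes>\<^bsub>G\<^esub> (inv\<^bsub>G\<^esub> u \<otimes>\<^bsub>G\<^esub> w)))"
      by (rule R.finsum_reindex) (use u in \<open>auto simp: inj_on_def\<close>)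
    also have "\<dots> = (\<Oplus>x\<in>P. g (inv\<^bsub>G\<^esub> u \<otimes>\<^bsub>G\<^esub> x) \<otimes> h (inv\<^bsub>G\<^esub> x \<otimes>\<^bsub>G\<^esub> w))"
    proof (rule R.finsum_cong')
      fix x assume x: "x \<in> P"
      \<comment> \<open>In the last argument of \<open>h\<close>, the inverse of \<open>u\<close>
        and \<open>u\<close> itself meet and cancel.\<close>
      have "u \<otimes>\<^bsub>G\<^esub> (inv\<^bsub>G\<^esub> u \<otimes>\<^bsub>G\<^esub> w) = w"
        using u by (simp flip: G.m_assoc)
      then show "g (inv\<^bsub>G\<^esub> u \<otimes>\<^bsub>G\<^esub> x) \<otimes>
          h (inv\<^bsub>G\<^esub> (inv\<^bsub>G\<^esub> u \<otimes>\<^bsub>G\<^esub> x) \<otimes>\<^bsub>G\<^esub> (inv\<^bsub>G\<^esub> u \<otimes>\<^bsub>G\<^esub> w)) =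
          g (inv\<^bsub>G\<^esub> u \<otimes>\<^bsub>G\<^esub> x) \<otimes> h (inv\<^bsub>G\<^esub> x \<otimes>\<^bsub>G\<^esub> w)"
        using u x by (simp add: G.inv_mult_group G.m_assoc)
    qed (use u in auto)
    finally show ?thesis .
  qed
  let ?h = "\<lambda>u x. f u \<otimes> (g (inv\<^bsub>G\<^esub> u \<otimes>\<^bsub>G\<^esub> x) \<otimes> h (inv\<^bsub>G\<^esub> x \<otimes>\<^bsub>G\<^esub> w))"
  have "((f \<otimes>\<^bsub>A\<^esub> g) \<otimes>\<^bsub>A\<^esub> h) w = (\<Oplus>x\<in>P. (f \<otimes>\<^bsub>A\<^esub> g) x \<otimes> h (inv\<^bsub>G\<^esub> x \<otimes>\<^bsub>G\<^esub> w))"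
    using P by (intro coeff_mult) (auto simp: mult_closed)
  also have "\<dots> = (\<Oplus>x\<in>P. \<Oplus>u\<in>S. ?h u x)"
  proof (rule R.finsum_cong')
    fix x assume x: "x \<in> P"
    have "(f \<otimes>\<^bsub>A\<^esub> g) x = (\<Oplus>u\<in>S. f u \<otimes> g (inv\<^bsub>G\<^esub> u \<otimes>\<^bsub>G\<^esub> x))"
      by (rule coeff_mult) (use x S in auto)
    then have "(f \<otimes>\<^bsub>A\<^esub> g) x \<otimes> h (inv\<^bsub>G\<^esub> x \<otimes>\<^bsub>G\<^esub> w) =
        (\<Oplus>u\<in>S. (f u \<otimes> g (inv\<^bsub>G\<^esub> u \<otimes>\<^bsub>G\<^esub> x)) \<otimes> h (inv\<^bsub>G\<^esub> x \<otimes>\<^bsub>G\<^esub> w))"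
      using x by (simp add: R.finsum_ldistr)
    also have "\<dots> = (\<Oplus>u\<in>S. ?h u x)"
      by (rule R.finsum_cong') (use x in \<open>auto simp: R.m_assoc\<close>)
    finally show "(f \<otimes>\<^bsub>A\<^esub> g) x \<otimes> h (inv\<^bsub>G\<^esub> x \<otimes>\<^bsub>G\<^esub> w) = (\<Oplus>u\<in>S. ?h u x)" .
  qed auto
  also have "\<dots> = (\<Oplus>u\<in>S. \<Oplus>x\<in>P. ?h u x)"
    by (rule R.add.finprod_swap) auto
  also have "\<dots> = (\<Oplus>u\<in>S. f u \<otimes> (g \<otimes>\<^bsub>A\<^esub> h) (inv\<^bsub>G\<^esub> u \<otimes>\<^bsub>G\<^esub> w))"
    by (rule R.finsum_cong') (auto simp: coeff_gh mult_closed R.finsum_rdistr)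
  also have "\<dots> = (f \<otimes>\<^bsub>A\<^esub> (g \<otimes>\<^bsub>A\<^esub> h)) w"
    by (rule coeff_mult[symmetric]) (use S in \<open>auto simp: mult_closed\<close>)
  finally show "((f \<otimes>\<^bsub>A\<^esub> g) \<otimes>\<^bsub>A\<^esub> h) w = (f \<otimes>\<^bsub>A\<^esub> (g \<otimes>\<^bsub>A\<^esub> h)) w" .
qed (use assms in \<open>simp_all add: mult_closed\<close>)

text \<open>The support of a basis element lies in \<open>{x}\<close>, so one term survives. It is
  empty if \<open>\<one> = \<zero>\<close> in \<open>R\<close>, a case that the inclusion in
  \<open>coeff_mult\<close> covers as well.\<close>

lemma coeff_of_mult:
  assumes x: "x \<in> carrier G" and g: "g \<in> carrier A" and w: "w \<in> carrier G"
  shows "(group_algebra_of R G x \<otimes>\<^bsub>A\<^esub> g) w = g (inv\<^bsub>G\<^esub> x \<otimes>\<^bsub>G\<^esub> w)"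
proof -
  have "(group_algebra_of R G x \<otimes>\<^bsub>A\<^esub> g) w =
      (\<Oplus>u\<in>{x}. group_algebra_of R G x u \<otimes> g (inv\<^bsub>G\<^esub> u \<otimes>\<^bsub>G\<^esub> w))"
    by (rule coeff_mult)
      (use assms in \<open>auto simp: group_algebra_of_closed\<close>, auto simp: group_algebra_of_def split: if_splits)
  then show ?thesis
    using assms by (simp add: group_algebra_of_def)
qed

lemma group_algebra_of_mult:
  assumes x: "x \<in> carrier G" and y: "y \<in> carrier G"
  shows "group_algebra_of R G x \<otimes>\<^bsub>A\<^esub> group_algebra_of R G y = group_algebra_of R G (x \<otimes>\<^bsub>G\<^esub> y)"
proof (rule group_algebra_eqI)
  fix w assume w: "w \<in> carrier G"
  have "inv\<^bsub>G\<^esub> x \<otimes>\<^bsub>G\<^esub> w = y \<longleftrightarrow> w = x \<otimes>\<^bsub>G\<^esub> y"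
    using x y w G.inv_solve_left' by auto
  then show "(group_algebra_of R G x \<otimes>\<^bsub>A\<^esub> group_algebra_of R G y) w = group_algebra_of R G (x \<otimes>\<^bsub>G\<^esub> y) w"
    using x y w by (simp add: coeff_of_mult group_algebra_of_closed) (simp add: group_algebra_of_def)
qed (use x y in \<open>simp_all add: mult_closed group_algebra_of_closed\<close>)

lemma mult_one:
  assumes f: "f \<in> carrier A"
  shows "f \<otimes>\<^bsub>A\<^esub> \<one>\<^bsub>A\<^esub> = f"
proof (rule group_algebra_eqI)
  fix w assume w: "w \<in> carrier G"
  \<comment> \<open>Only the term \<open>u = w\<close> can survive. Inserting \<open>w\<close>
    ensures that it is indexed even when \<open>f w = \<zero>\<close>.\<close>
  have S: "finite (insert w (supp f))"
    using f by (simp add: carrier_group_algebra)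
  have "(f \<otimes>\<^bsub>A\<^esub> \<one>\<^bsub>A\<^esub>) w = (\<Oplus>u\<in>insert w (supp f). f u \<otimes> \<one>\<^bsub>A\<^esub> (inv\<^bsub>G\<^esub> u \<otimes>\<^bsub>G\<^esub> w))"
    using f w S by (intro coeff_mult) (auto simp: one_closed)
  also have "\<dots> = (\<Oplus>u\<in>insert w (supp f). if w = u then f u else \<zero>)"
    by (rule R.finsum_cong') (use f w in \<open>auto simp: coeff_one G.inv_solve_left'\<close>)
  also have "\<dots> = f w"
    using R.finsum_singleton[OF _ S, of w f] f w by auto
  finally show "(f \<otimes>\<^bsub>A\<^esub> \<one>\<^bsub>A\<^esub>) w = f w" .
qed (use f in \<open>simp_all add: mult_closed one_closed\<close>)

lemma add_mult:
  assumes f: "f \<in> carrier A" and g: "g \<in> carrier A" and h: "h \<in> carrier A"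
  shows "(f \<oplus>\<^bsub>A\<^esub> g) \<otimes>\<^bsub>A\<^esub> h = f \<otimes>\<^bsub>A\<^esub> h \<oplus>\<^bsub>A\<^esub> g \<otimes>\<^bsub>A\<^esub> h"
proof (rule group_algebra_eqI)
  fix w assume w: "w \<in> carrier G"
  \<comment> \<open>Cancellation can make the support of the sum smaller than this union; the union
    works for all three products at once.\<close>
  let ?S = "supp f \<union> supp g"
  have S: "finite ?S"
    using f g by (simp add: carrier_group_algebra)
  have "((f \<oplus>\<^bsub>A\<^esub> g) \<otimes>\<^bsub>A\<^esub> h) w = (\<Oplus>u\<in>?S. (f \<oplus>\<^bsub>A\<^esub> g) u \<otimes> h (inv\<^bsub>G\<^esub> u \<otimes>\<^bsub>G\<^esub> w))"
    using f g h w S by (intro coeff_mult) (auto simp: add_closed)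
  also have "\<dots> = (\<Oplus>u\<in>?S. f u \<otimes> h (inv\<^bsub>G\<^esub> u \<otimes>\<^bsub>G\<^esub> w) \<oplus> g u \<otimes> h (inv\<^bsub>G\<^esub> u \<otimes>\<^bsub>G\<^esub> w))"
    by (rule R.finsum_cong') (use f g h w in \<open>auto simp: R.l_distr\<close>)
  also have "\<dots> = (\<Oplus>u\<in>?S. f u \<otimes> h (inv\<^bsub>G\<^esub> u \<otimes>\<^bsub>G\<^esub> w)) \<oplus> (\<Oplus>u\<in>?S. g u \<otimes> h (inv\<^bsub>G\<^esub> u \<otimes>\<^bsub>G\<^esub> w))"
    by (rule R.finsum_addf) (use f g h w in auto)
  also have "\<dots> = (f \<otimes>\<^bsub>A\<^esub> h) w \<oplus> (g \<otimes>\<^bsub>A\<^esub> h) w"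
    using coeff_mult[OF f h w S] coeff_mult[OF g h w S] by auto
  finally show "((f \<oplus>\<^bsub>A\<^esub> g) \<otimes>\<^bsub>A\<^esub> h) w = (f \<otimes>\<^bsub>A\<^esub> h \<oplus>\<^bsub>A\<^esub> g \<otimes>\<^bsub>A\<^esub> h) w"
    using w by simp
qed (use assms in \<open>simp_all add: mult_closed add_closed\<close>)

lemma mult_add:
  assumes f: "f \<in> carrier A" and g: "g \<in> carrier A" and h: "h \<in> carrier A"
  shows "h \<otimes>\<^bsub>A\<^esub> (f \<oplus>\<^bsub>A\<^esub> g) = h \<otimes>\<^bsub>A\<^esub> f \<oplus>\<^bsub>A\<^esub> h \<otimes>\<^bsub>A\<^esub> g"
proof (rule group_algebra_eqI)
  fix w assume w: "w \<in> carrier G"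
  let ?S = "supp h"
  have S: "finite ?S"
    using h by (simp add: carrier_group_algebra)
  have "(h \<otimes>\<^bsub>A\<^esub> (f \<oplus>\<^bsub>A\<^esub> g)) w = (\<Oplus>u\<in>?S. h u \<otimes> (f \<oplus>\<^bsub>A\<^esub> g) (inv\<^bsub>G\<^esub> u \<otimes>\<^bsub>G\<^esub> w))"
    using f g h w S by (intro coeff_mult) (auto simp: add_closed)
  also have "\<dots> = (\<Oplus>u\<in>?S. h u \<otimes> f (inv\<^bsub>G\<^esub> u \<otimes>\<^bsub>G\<^esub> w) \<oplus> h u \<otimes> g (inv\<^bsub>G\<^esub> u \<otimes>\<^bsub>G\<^esub> w))"
    by (rule R.finsum_cong') (use f g h w in \<open>auto simp: R.r_distr\<close>)
  also have "\<dots> = (\<Oplus>u\<in>?S. h u \<otimes> f (inv\<^bsub>G\<^esub> u \<otimes>\<^bsub>G\<^esub> w)) \<oplus> (\<Oplus>u\<in>?S. h u \<otimes> g (inv\<^bsub>G\<^esub> u \<otimes>\<^bsub>G\<^esub> w))"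
    by (rule R.finsum_addf) (use f g h w in auto)
  also have "\<dots> = (h \<otimes>\<^bsub>A\<^esub> f) w \<oplus> (h \<otimes>\<^bsub>A\<^esub> g) w"
    using coeff_mult[OF h f w S] coeff_mult[OF h g w S] by auto
  finally show "(h \<otimes>\<^bsub>A\<^esub> (f \<oplus>\<^bsub>A\<^esub> g)) w = (h \<otimes>\<^bsub>A\<^esub> f \<oplus>\<^bsub>A\<^esub> h \<otimes>\<^bsub>A\<^esub> g) w"
    using w by simp
qed (use assms in \<open>simp_all add: mult_closed add_closed\<close>)

lemma ring_group_algebra: "ring A"
proof (rule ringI)
  show "abelian_group A"
  proof (rule abelian_groupI)
    fix f assume f: "f \<in> carrier A"
    \<comment> \<open>The additive inverse negates each coefficient; the restricted abstraction
      keeps it \<open>undefined\<close> off the carrier of \<open>G\<close>.\<close>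
    let ?f = "\<lambda>w\<in>carrier G. \<ominus> f w"
    have "supp ?f \<subseteq> supp f"
      by auto
    then have "finite (supp ?f)"
      by (rule finite_subset) (use f in \<open>simp add: carrier_group_algebra\<close>)
    then have closed: "?f \<in> carrier A"
      using f by (auto simp: carrier_group_algebra)
    moreover have "?f \<oplus>\<^bsub>A\<^esub> f = \<zero>\<^bsub>A\<^esub>"
      using f closed by (intro group_algebra_eqI) (auto simp: add_closed zero_closed R.l_neg)
    ultimately show "\<exists>g\<in>carrier A. g \<oplus>\<^bsub>A\<^esub> f = \<zero>\<^bsub>A\<^esub>"
      by blast
  qed (auto intro!: group_algebra_eqI simp: add_closed zero_closed R.a_ac)
  show "monoid A"
  proof (rule monoidI)
    fix f assume f: "f \<in> carrier A"
    show "\<one>\<^bsub>A\<^esub> \<otimes>\<^bsub>A\<^esub> f = f"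
      by (rule group_algebra_eqI) (use f in \<open>auto simp: mult_closed one_closed\<close>,
        simp add: one_eq coeff_of_mult)
  qed (simp_all add: mult_closed one_closed mult_assoc mult_one)
qed (simp_all add: add_mult mult_add)

end


subsection \<open>Cycles of consecutive numbers\<close>

lemma cycle_of_list_upt:
  assumes "l \<le> m"
  shows "cycle_of_list [l..<Suc m] x = (if x < l \<or> m < x then x else if x = m then l else x + 1)"
  using assms
\<comment> \<open>Induction runs downward from \<open>l = m\<close>, where the cycle is the
  identity, because \<open>cycle_of_list\<close> splits off a transposition at the head of the
  list.\<close>
proof (induction l rule: inc_induct)
  case base
  then show ?case
    by auto
next
  case (step l)
  have "[l..<Suc m] = l # Suc l # [Suc (Suc l)..<Suc m]" "[Suc l..<Suc m] = Suc l # [Suc (Suc l)..<Suc m]"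
    using step.hyps by (simp_all add: upt_rec)
  then have "cycle_of_list [l..<Suc m] = Transposition.transpose l (Suc l) \<circ> cycle_of_list [Suc l..<Suc m]"
    by simp
  then show ?case
    using step by (auto simp: Transposition.transpose_def)
qed

lemma cycle_of_list_upt_in_sym_group:
  assumes "1 \<le> l" and "m \<le> n"
  shows "cycle_of_list [l..<Suc m] \<in> carrier (sym_group n)"
  unfolding sym_group_carrier using assms
  by (intro permutes_subset[OF cycle_permutes]) auto

text \<open>This is a conjugation: since \<open>k < m\<close>, the cycle
  \<open>c\<^sub>i\<^sub>,\<^sub>m\<close> shifts each of \<open>i, ..., k\<close> up by one, so it
  conjugates \<open>c\<^sub>i\<^sub>,\<^sub>k\<close> to
  \<open>c\<^sub>i\<^sub>+\<^sub>1\<^sub>,\<^sub>k\<^sub>+\<^sub>1\<close>. The explicit formula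
  confirms it pointwise.\<close>

lemma cycle_of_list_upt_comp_less:
  assumes "i \<le> k" and "k < m"
  shows "cycle_of_list [i..<Suc m] \<circ> cycle_of_list [i..<Suc k] =
    cycle_of_list [i + 1..<Suc (k + 1)] \<circ> cycle_of_list [i..<Suc m]"
  using assms by (intro ext) (auto simp: cycle_of_list_upt simp del: upt_Suc)

text \<open>Conceptually, this is the preceding identity with \<open>k\<close> and \<open>m\<close>
  exchanged, multiplied on the left by the transposition of \<open>i\<close> and
  \<open>i + 1\<close>: that factor shortens \<open>c\<^sub>i\<^sub>,\<^sub>k\<close> to
  \<open>c\<^sub>i\<^sub>+\<^sub>1\<^sub>,\<^sub>k\<close> and extends
  \<open>c\<^sub>i\<^sub>+\<^sub>1\<^sub>,\<^sub>m\<^sub>+\<^sub>1\<close> to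
  \<open>c\<^sub>i\<^sub>,\<^sub>m\<^sub>+\<^sub>1\<close>. Writing \<open>m + 1\<close> avoids a
  subtraction.\<close>

lemma cycle_of_list_upt_comp_greater:
  assumes "i \<le> m" and "m < k"
  shows "cycle_of_list [i..<Suc (m + 1)] \<circ> cycle_of_list [i..<Suc k] =
    cycle_of_list [i + 1..<Suc k] \<circ> cycle_of_list [i..<Suc m]"
  using assms by (intro ext) (auto simp: cycle_of_list_upt simp del: upt_Suc)


section \<open>Matching the double sums of the shuffle products\<close>

theorem theorem5p1:
  fixes R :: "('r, 'm) ring_scheme" and n i :: nat
  assumes "cring R" and "i \<in> {1..n - 1}"
  defines "A \<equiv> group_algebra R (sym_group n)"
    and "t \<equiv> somewhere_to_below R n"
  shows "t (i + 1) \<otimes>\<^bsub>A\<^esub> t i = (t i \<ominus>\<^bsub>A\<^esub> \<one>\<^bsub>A\<^esub>) \<otimes>\<^bsub>A\<^esub> t i \<and>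
    (t i \<ominus>\<^bsub>A\<^esub> \<one>\<^bsub>A\<^esub>) \<otimes>\<^bsub>A\<^esub> t i = t i \<otimes>\<^bsub>A\<^esub> (t i \<ominus>\<^bsub>A\<^esub> \<one>\<^bsub>A\<^esub>)"
proof -
  interpret GA: ring_and_group R "sym_group n"
    using assms(1) sym_group_is_group by (simp add: ring_and_group_def cring_def)
  interpret A: ring A
    unfolding A_def by (rule GA.ring_group_algebra)
  have i: "1 \<le> i" "i < n"
    using assms(2) by auto
  define c where "c l m = cycle_of_list [l..<Suc m]" for l m :: nat
  define of_perm where "of_perm = group_algebra_of R (sym_group n)"
  have c_closed: "c l m \<in> carrier (sym_group n)" if "1 \<le> l" "m \<le> n" for l m
    unfolding c_def by (rule cycle_of_list_upt_in_sym_group[OF that])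
  have of_closed: "of_perm p \<in> carrier A" if "p \<in> carrier (sym_group n)" for p
    unfolding of_perm_def A_def by (rule GA.group_algebra_of_closed[OF that])
  have of_mult: "of_perm p \<otimes>\<^bsub>A\<^esub> of_perm q = of_perm (p \<circ> q)"
    if "p \<in> carrier (sym_group n)" "q \<in> carrier (sym_group n)" for p q
    using GA.group_algebra_of_mult[OF that] by (simp add: of_perm_def A_def sym_group_mult)
  have comp_closed: "p \<circ> q \<in> carrier (sym_group n)"
    if "p \<in> carrier (sym_group n)" "q \<in> carrier (sym_group n)" for p q
    using GA.G.m_closed[OF that] by (simp add: sym_group_mult)
  note closed = of_closed c_closed comp_closed
  have t: "t l = (\<Oplus>\<^bsub>A\<^esub>m\<in>{l..n}. of_perm (c l m))" for l
    by (simp add: t_def somewhere_to_below_def A_def of_perm_def c_def)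
  have t_closed: "t i \<in> carrier A"
    unfolding t using i by (intro A.finsum_closed) (auto intro!: closed)
  \<comment> \<open>This is \<open>t i\<close> without the term \<open>m = i\<close>, whose
    one-element cycle is the identity; hence it will equal \<open>t i\<close> minus one.\<close>
  define s where "s = (\<Oplus>\<^bsub>A\<^esub>m\<in>{i + 1..n}. of_perm (c i m))"
  have s_closed: "s \<in> carrier A"
    unfolding s_def using i by (intro A.finsum_closed) (auto intro!: closed)
  have "c i i = id"
    by (auto simp: c_def cycle_of_list_upt)
  then have "of_perm (c i i) = \<one>\<^bsub>A\<^esub>"
    by (simp add: of_perm_def A_def GA.one_eq sym_group_one)
  moreover have "t i = of_perm (c i i) \<oplus>\<^bsub>A\<^esub> s"
  proof -
    have "{i..n} = insert i {i + 1..n}"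
      using i by auto
    then show ?thesis
      unfolding t s_def using i by (simp add: A.finsum_insert Pi_def closed)
  qed
  ultimately have s: "t i \<ominus>\<^bsub>A\<^esub> \<one>\<^bsub>A\<^esub> = s"
    using s_closed by (simp add: A.minus_eq A.a_comm[of "\<one>\<^bsub>A\<^esub>"] A.a_assoc A.r_neg)
  define D where "D = {i + 1..n} \<times> {i..n}"
  define \<phi> where "\<phi> = (\<lambda>(m :: nat, k :: nat). if k < m then (k + 1, m) else (k, m - 1))"
  define h where "h = (\<lambda>(m, k). of_perm (c (i + 1) m \<circ> c i k))"
  \<comment> \<open>The two cases of \<open>\<phi>\<close> exchange the regions \<open>k < m\<close>
    and \<open>m \<le> k\<close> of \<open>D\<close>, and each undoes the other. As
    \<open>m \<ge> i + 1\<close> on \<open>D\<close>, the subtraction in \<open>m - 1\<close> is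
    genuine and its result is still at least \<open>i\<close>.\<close>
  have \<phi>_D: "\<phi> p \<in> D" and \<phi>_\<phi>: "\<phi> (\<phi> p) = p" if "p \<in> D" for p
    using that by (auto simp: D_def \<phi>_def split: if_splits)
  have \<phi>: "\<phi> ` D = D" "inj_on \<phi> D"
    using \<phi>_D \<phi>_\<phi> by (force, metis inj_onI)
  have h: "h \<in> D \<rightarrow> carrier A"
    using i by (auto simp: h_def D_def intro!: closed)
  \<comment> \<open>For \<open>k < m\<close> this is the conjugation identity; for
    \<open>m \<le> k\<close> the other cycle identity applies at \<open>m - 1\<close>, whose
    successor is \<open>m\<close>.\<close>
  have h_\<phi>: "h (\<phi> (m, k)) = of_perm (c i m \<circ> c i k)" if "(m, k) \<in> D" for m k
    using that cycle_of_list_upt_comp_less[of i k m] cycle_of_list_upt_comp_greater[of i "m - 1" k]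
    by (auto simp: h_def \<phi>_def D_def c_def simp del: upt_Suc)
  have "t (i + 1) \<otimes>\<^bsub>A\<^esub> t i =
      finsum A (\<lambda>(m, k). of_perm (c (i + 1) m) \<otimes>\<^bsub>A\<^esub> of_perm (c i k)) D"
    unfolding t D_def using i by (intro A.finsum_mult_finsum) (auto intro!: closed)
  also have "\<dots> = finsum A h D"
    using h i by (intro A.finsum_cong') (auto simp: h_def D_def of_mult c_closed)
  \<comment> \<open>Since \<open>\<phi>\<close> permutes \<open>D\<close>, it may be used to reindex
    the sum, turning the terms of the first product into those of \<open>s\<close> times
    \<open>t i\<close>.\<close>
  also have "\<dots> = finsum A (h \<circ> \<phi>) D"
    using A.finsum_reindex[of h \<phi> D] h \<phi> by (simp add: o_def)
  also have "\<dots> = finsum A (\<lambda>(m, k). of_perm (c i m) \<otimes>\<^bsub>A\<^esub> of_perm (c i k)) D"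
    using i by (intro A.finsum_cong') (auto simp: h_\<phi>, auto simp: D_def of_mult closed)
  also have "\<dots> = s \<otimes>\<^bsub>A\<^esub> t i"
    unfolding t s_def D_def using i
    by (intro A.finsum_mult_finsum[symmetric]) (auto intro!: closed)
  finally have "t (i + 1) \<otimes>\<^bsub>A\<^esub> t i = s \<otimes>\<^bsub>A\<^esub> t i" .
  \<comment> \<open>Both sides expand to the square of \<open>t i\<close> minus
    \<open>t i\<close>.\<close>
  moreover have "(t i \<ominus>\<^bsub>A\<^esub> \<one>\<^bsub>A\<^esub>) \<otimes>\<^bsub>A\<^esub> t i = t i \<otimes>\<^bsub>A\<^esub> (t i \<ominus>\<^bsub>A\<^esub> \<one>\<^bsub>A\<^esub>)"
    using t_closed by (simp add: A.minus_eq A.l_distr A.r_distr A.l_minus A.r_minus)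
  ultimately show ?thesis
    by (simp add: s)
qed

end
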